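(* Let $p$ be an odd prime and let $G$ be a finite $p$-group of nilpotency class $c$. (a) If $p>2c-1$, then $\mathcal{B}(G)\subseteq\mathcal{W}(G)$ and $G$ is a $J$-group. (b) If $p^2>2c-1$, then $\mathcal{B}(\gamma_d(G))\subseteq\mathcal{W}(G)$, where $d$ is the largest integer such that $\exp(\gamma_d(G))=\exp(G)$, and $G$ is a $J$-group.
   Context: A group $G$ is a $J$-group if there exist an element $k\in G$ and a function $f\colon G\to G$ with $f(xk)=xf(x)$ for all $x\in G$. An element $k\in G$ of finite order $n=|k|$ is a witness for $G$ if $\prod_{i=1}^{n} xk^{n-i}=1$ for all $x\in G$, where the product is taken in order of increasing $i$ from left to right, i.e. it equals $xk^{n-1}xk^{n-2}\cdots xk^2\,xk\,x$. $\mathcal{W}(G)$ denotes the set of all witnesses for $G$. The exponent is $\exp(G)=\mathrm{lcm}\{|g| : g\in G\}$, and $\mathcal{B}(G)=\{x\in G : |x|=\exp(G)\}$ is the set of big elements (for a subgroup $H$, $\mathcal{B}(H)$ is defined with respect to $\exp(H)$). The lower central series is $\gamma_1(G)=G$, $\gamma_{i+1}(G)=[\gamma_i(G),G]$; the nilpotency class is the least $c\ge 0$ with $\gamma_{c+1}(G)=1$. If $G$ is trivial, so that no largest $d$ exists, $d$ is taken to be $1$. *)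

theory Defs
  imports "HOL-Algebra.Algebra"
begin

definition J_group :: "('a, 'b) monoid_scheme \<Rightarrow> bool" where
  "J_group G \<longleftrightarrow> group G \<and>
     (\<exists>k\<in>carrier G. \<exists>f\<in>carrier G \<rightarrow> carrier G.
        \<forall>x\<in>carrier G. f (x \<otimes>\<^bsub>G\<^esub> k) = x \<otimes>\<^bsub>G\<^esub> f x)"

text \<open>The product \<open>x k\<^sup>n\<^sup>-\<^sup>1 x k\<^sup>n\<^sup>-\<^sup>2 \<dots> x k x\<close>, from left to right.\<close>

definition witness_product :: "('a, 'b) monoid_scheme \<Rightarrow> 'a \<Rightarrow> 'a \<Rightarrow> nat \<Rightarrow> 'a" where
  "witness_product G x k n =
     foldr (\<otimes>\<^bsub>G\<^esub>) (map (\<lambda>i. x \<otimes>\<^bsub>G\<^esub> k [^]\<^bsub>G\<^esub> (n - i)) [1..<Suc n]) \<one>\<^bsub>G\<^esub>"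

text \<open>\<^const>\<open>group.ord\<close> is 0 on elements of infinite order.\<close>

definition witnesses :: "('a, 'b) monoid_scheme \<Rightarrow> 'a set" where
  "witnesses G = {k \<in> carrier G. group.ord G k \<noteq> 0 \<and>
     (\<forall>x\<in>carrier G. witness_product G x k (group.ord G k) = \<one>\<^bsub>G\<^esub>)}"

definition group_exponent :: "('a, 'b) monoid_scheme \<Rightarrow> nat" where
  "group_exponent G = Lcm (group.ord G ` carrier G)"

definition big_elements :: "('a, 'b) monoid_scheme \<Rightarrow> 'a set" where
  "big_elements G = {x \<in> carrier G. group.ord G x = group_exponent G}"

definition commutator_subgroup :: "('a, 'b) monoid_scheme \<Rightarrow> 'a set \<Rightarrow> 'a set \<Rightarrow> 'a set" where
  "commutator_subgroup G H K = generate G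
     (\<Union>h\<in>H. \<Union>k\<in>K. {h \<otimes>\<^bsub>G\<^esub> k \<otimes>\<^bsub>G\<^esub> inv\<^bsub>G\<^esub> h \<otimes>\<^bsub>G\<^esub> inv\<^bsub>G\<^esub> k})"

text \<open>The series is indexed from 1; the value at 0 is a dummy.\<close>

fun lower_central :: "('a, 'b) monoid_scheme \<Rightarrow> nat \<Rightarrow> 'a set" where
  "lower_central G 0 = carrier G"
| "lower_central G (Suc 0) = carrier G"
| "lower_central G (Suc (Suc i)) =
     commutator_subgroup G (lower_central G (Suc i)) (carrier G)"

abbreviation lower_central_group ::
  "('a, 'b) monoid_scheme \<Rightarrow> nat \<Rightarrow> ('a, 'b) monoid_scheme" where
  "lower_central_group G i \<equiv> G\<lparr>carrier := lower_central G i\<rparr>"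

definition has_nilpotency_class :: "('a, 'b) monoid_scheme \<Rightarrow> nat \<Rightarrow> bool" where
  "has_nilpotency_class G c \<longleftrightarrow>
     lower_central G (c + 1) = {\<one>\<^bsub>G\<^esub>} \<and>
     (\<forall>b<c. lower_central G (b + 1) \<noteq> {\<one>\<^bsub>G\<^esub>})"

definition exponent_depth :: "('a, 'b) monoid_scheme \<Rightarrow> nat" where
  "exponent_depth G =
     (if carrier G = {\<one>\<^bsub>G\<^esub>} then 1
      else GREATEST d. 1 \<le> d \<and> group_exponent (lower_central_group G d) = group_exponent G)"

end

theory Submission
  imports Defs
begin

text \<open>
  Let \<open>k\<close> have order \<open>n\<close>. Since \<open>k\<^sup>n = 1\<close>, the witness product at \<open>x\<close> is the value at \<open>n\<close> of the
  sequence \<open>P m = (x k\<^sup>-\<^sup>1) (x k\<^sup>-\<^sup>2) \<dots> (x k\<^sup>-\<^sup>m)\<close>, whose successive quotients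
  \<open>(P m)\<^sup>-\<^sup>1 P (m + 1) = x k\<^sup>-\<^sup>(\<^sup>m\<^sup>+\<^sup>1\<^sup>)\<close> are linear in \<open>m\<close>. So \<open>P\<close> is a polynomial sequence in the sense of
  Lazard and Leibman: for a suitable filtration \<open>F\<^sub>0 \<supseteq> F\<^sub>1 \<supseteq> F\<^sub>2 \<supseteq> \<dots>\<close> of the group it has a Taylor expansion,
  a product of factors \<open>w\<^sub>j\<close> raised to the power \<open>m choose j\<close> with \<open>w\<^sub>j \<in> F\<^sub>j\<close>. At \<open>m = n\<close> the product is
  trivial as soon as \<open>w\<close> to the power \<open>n choose j\<close> is trivial for all \<open>j \<ge> 1\<close> and \<open>w \<in> F\<^sub>j\<close>
  (\<open>polynomial_sequence_vanishes\<close>).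

  The filtration must have \<open>x\<close> in degree 1 and \<open>k\<close> in degree 2. If \<open>k\<close> lies in the term \<open>\<gamma>\<^sub>d\<close> of the
  lower central series, let \<open>K\<close> be generated by \<open>x\<close>, \<open>k\<close> and \<open>\<gamma>\<^sub>d\<^sub>+\<^sub>1\<close>, and take \<open>F\<^sub>0 = F\<^sub>1 = F\<^sub>2 = K\<close> and \<open>F\<^sub>j\<close>, for
  \<open>j \<ge> 3\<close>, the intersection of \<open>\<gamma>\<^sub>d\<^sub>+\<^sub>1\<close> with the term of index \<open>j / 2\<close> rounded up. This respects commutators
  because \<open>K\<close> is commutative modulo \<open>\<gamma>\<^sub>d\<^sub>+\<^sub>1\<close> and because the lower central series is strongly central, that
  is, \<open>[\<gamma>\<^sub>i, \<gamma>\<^sub>j] \<subseteq> \<gamma>\<^sub>i\<^sub>+\<^sub>j\<close>. In class \<open>c\<close> it makes \<open>F\<^sub>j\<close> trivial for \<open>j > 2 c\<close>, so the degree \<open>j\<close> only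
  matters up to \<open>2 c\<close>.

  Now let \<open>n = p\<^sup>e\<close> be the exponent of the group. For \<open>1 \<le> j < p\<close> the binomial coefficient \<open>n choose j\<close> is
  divisible by \<open>n\<close>, and for \<open>1 \<le> j < p\<^sup>2\<close> at least by \<open>n / p\<close> if \<open>n > 1\<close>. As \<open>p\<close> is odd, \<open>p > 2 c - 1\<close> means
  \<open>p > 2 c\<close>, and likewise for \<open>p\<^sup>2\<close>. Thus in (a), with \<open>d = 1\<close>, all degrees are below \<open>p\<close> and
  each factor dies. In (b) the
  degrees from \<open>p\<close> on are at least 3, so their factors lie in \<open>\<gamma>\<^sub>d\<^sub>+\<^sub>1\<close>, whose exponent divides \<open>n / p\<close> by
  the maximality of \<open>d\<close>. Finally, a witness makes the group a \<open>J\<close>-group: the recursion \<open>f (x k) = x f x\<close>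
  determines \<open>f\<close> along the cycles of right multiplication by \<open>k\<close>, and going once around a cycle multiplies
  by the witness product.
\<close>

section \<open>Commutator calculus\<close>

abbreviation commutator :: "('a, 'b) monoid_scheme \<Rightarrow> 'a \<Rightarrow> 'a \<Rightarrow> 'a" where
  "commutator G x y \<equiv> x \<otimes>\<^bsub>G\<^esub> y \<otimes>\<^bsub>G\<^esub> inv\<^bsub>G\<^esub> x \<otimes>\<^bsub>G\<^esub> inv\<^bsub>G\<^esub> y"

context group
begin

lemma inv_mult_cancel:
  assumes "x \<in> carrier G" "y \<in> carrier G"
  shows "inv x \<otimes> (x \<otimes> y) = y" and "x \<otimes> (inv x \<otimes> y) = y"
  using assms by (simp_all add: m_assoc [symmetric])

lemmas word_simps = m_assoc inv_mult_group inv_mult_cancel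

text \<open>
  Modulo a subgroup normalized by \<open>g\<close> and \<open>h\<close>, \<open>[g a, h b]\<close> equals \<open>[g, h]\<close> if \<open>a\<close> commutes with
  \<open>h\<close> and \<open>b\<close> commutes with both \<open>g\<close> and \<open>a\<close>. It is the step from \<open>n\<close> to \<open>n + 1\<close> in a commutator of two
  sequences with successive quotients \<open>a\<close> and \<open>b\<close>. There the subgroup consists of polynomial
  sequences and is not normal among all sequences, so instead of passing to a factor group the proof
  writes the quotient as an explicit product of conjugates of the three given commutators.
\<close>

lemma commutator_perturb:
  assumes M: "subgroup M G"
    and carr: "g \<in> carrier G" "h \<in> carrier G" "a \<in> carrier G" "b \<in> carrier G"
    and normg: "\<And>x. x \<in> M \<Longrightarrow> g \<otimes> x \<otimes> inv g \<in> M" "\<And>x. x \<in> M \<Longrightarrow> inv g \<otimes> x \<otimes> g \<in> M"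
    and normh: "\<And>x. x \<in> M \<Longrightarrow> h \<otimes> x \<otimes> inv h \<in> M" "\<And>x. x \<in> M \<Longrightarrow> inv h \<otimes> x \<otimes> h \<in> M"
    and comm: "commutator G a h \<in> M" "commutator G a b \<in> M" "commutator G g b \<in> M"
  shows "inv (commutator G g h) \<otimes> commutator G (g \<otimes> a) (h \<otimes> b) \<in> M"
proof -
  \<comment> \<open>\<open>[g a, h b] = y [g, h] (h [g, b] h\<^sup>-\<^sup>1)\<close>; below, \<open>y\<close> is conjugated past \<open>[g, h]\<close> letter by letter.\<close>
  define y where "y = g \<otimes> (commutator G a h \<otimes> (h \<otimes> commutator G a b \<otimes> inv h)) \<otimes> inv g"
  have y: "y \<in> M"
    unfolding y_def by (intro normg normh subgroup.m_closed [OF M] comm)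
  have "h \<otimes> (g \<otimes> (inv h \<otimes> (inv g \<otimes> y \<otimes> g) \<otimes> h) \<otimes> inv g) \<otimes> inv h \<in> M" (is "?y \<in> M")
    by (intro normg normh y)
  moreover have "h \<otimes> commutator G g b \<otimes> inv h \<in> M" (is "?z \<in> M")
    by (intro normh comm)
  ultimately have "?y \<otimes> ?z \<in> M"
    by (rule subgroup.m_closed [OF M])
  also have "?y \<otimes> ?z = inv (commutator G g h) \<otimes> commutator G (g \<otimes> a) (h \<otimes> b)"
    unfolding y_def using carr by (simp add: word_simps)
  finally show ?thesis .
qed

text \<open>
  Modulo a normal subgroup \<open>N\<close>, the elements that commute with \<open>x\<close> form a subgroup, so commutation need
  only be tested on generators.
\<close>

lemma commutator_generate_right:
  assumes N: "N \<lhd> G" and x: "x \<in> carrier G" and A: "A \<subseteq> carrier G"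
    and comm: "\<And>a. a \<in> A \<Longrightarrow> commutator G x a \<in> N"
    and u: "u \<in> generate G A"
  shows "commutator G x u \<in> N"
proof -
  interpret N: normal N G by (rule N)
  have inv_step: "commutator G x (inv a) \<in> N" if "a \<in> carrier G" "commutator G x a \<in> N" for a
  proof -
    have "inv a \<otimes> inv (commutator G x a) \<otimes> a \<in> N"
      using that N.inv_op_closed1 by simp
    also have "inv a \<otimes> inv (commutator G x a) \<otimes> a = commutator G x (inv a)"
      using that x by (simp add: word_simps)
    finally show ?thesis .
  qed
  from u show ?thesis
  proof (induction rule: generate.induct)
    case one
    then show ?case using x by simp
  next
    case (incl a)
    then show ?case using comm by blast
  next
    case (inv a)
    then show ?case using comm A inv_step by blast
  next
    case (eng a b)
    have [simp]: "a \<in> carrier G" "b \<in> carrier G"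
      using eng.hyps A generate_in_carrier by auto
    have "commutator G x a \<otimes> (a \<otimes> commutator G x b \<otimes> inv a) \<in> N"
      using eng.IH N.inv_op_closed2 by simp
    also have "commutator G x a \<otimes> (a \<otimes> commutator G x b \<otimes> inv a) = commutator G x (a \<otimes> b)"
      using x by (simp add: word_simps)
    finally show ?case .
  qed
qed

lemma commutator_swap:
  assumes "subgroup N G" "x \<in> carrier G" "y \<in> carrier G" "commutator G x y \<in> N"
  shows "commutator G y x \<in> N"
proof -
  have "inv (commutator G x y) \<in> N"
    using assms by (simp add: subgroup.m_inv_closed)
  also have "inv (commutator G x y) = commutator G y x"
    using assms by (simp add: word_simps)
  finally show ?thesis .
qed

lemma commutator_generate_generate:
  assumes N: "N \<lhd> G" and A: "A \<subseteq> carrier G"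
    and comm: "\<And>a b. a \<in> A \<Longrightarrow> b \<in> A \<Longrightarrow> commutator G a b \<in> N"
    and u: "u \<in> generate G A" and v: "v \<in> generate G A"
  shows "commutator G u v \<in> N"
proof -
  have Nsub: "subgroup N G" using N by (rule normal_imp_subgroup)
  have uc: "u \<in> carrier G" using u A generate_in_carrier by auto
  have "commutator G u a \<in> N" if a: "a \<in> A" for a
  proof -
    have ac: "a \<in> carrier G" using a A by auto
    have "commutator G a u \<in> N"
      using N ac A comm [OF a] u by (rule commutator_generate_right)
    then show ?thesis using commutator_swap [OF Nsub ac uc] by simp
  qed
  with N uc A show ?thesis using v by (rule commutator_generate_right)
qed

section \<open>The lower central series is strongly central\<close>

lemma lower_central_Suc:
  "i > 0 \<Longrightarrow> lower_central G (Suc i) = commutator_subgroup G (lower_central G i) (carrier G)"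
  by (cases i) auto

lemma commutator_subgroup_normal:
  assumes H: "H \<lhd> G"
  shows "commutator_subgroup G H (carrier G) \<lhd> G"
    and "commutator_subgroup G H (carrier G) \<subseteq> H"
proof -
  interpret H: normal H G by (rule H)
  let ?X = "\<Union>h\<in>H. \<Union>k\<in>carrier G. {commutator G h k}"
  have eq: "commutator_subgroup G H (carrier G) = generate G ?X"
    by (simp add: commutator_subgroup_def)
  have X: "?X \<subseteq> carrier G" by auto
  show "commutator_subgroup G H (carrier G) \<lhd> G"
    unfolding eq
  proof (rule normal_generateI [OF X])
    fix h g assume "h \<in> ?X" and g: "g \<in> carrier G"
    then obtain a k where a: "a \<in> H" and k: "k \<in> carrier G" and h: "h = commutator G a k"
      by auto
    have [simp]: "a \<in> carrier G" using a by auto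
    have "g \<otimes> h \<otimes> inv g = commutator G (g \<otimes> a \<otimes> inv g) (g \<otimes> k \<otimes> inv g)"
      unfolding h using g k by (simp add: word_simps)
    moreover have "g \<otimes> a \<otimes> inv g \<in> H" using a g by (rule H.inv_op_closed2 [rotated])
    moreover have "g \<otimes> k \<otimes> inv g \<in> carrier G" using g k by simp
    ultimately show "g \<otimes> h \<otimes> inv g \<in> ?X" by blast
  qed
  have "?X \<subseteq> H"
  proof
    fix h assume "h \<in> ?X"
    then obtain a k where a: "a \<in> H" and k: "k \<in> carrier G" and h: "h = commutator G a k"
      by auto
    have [simp]: "a \<in> carrier G" using a by auto
    have "a \<otimes> (k \<otimes> inv a \<otimes> inv k) \<in> H"
      using a k by (intro H.m_closed H.inv_op_closed2 H.m_inv_closed)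
    then show "h \<in> H" unfolding h using k by (simp add: word_simps)
  qed
  then show "commutator_subgroup G H (carrier G) \<subseteq> H"
    unfolding eq using H.subgroup_axioms by (rule generate_subgroup_incl)
qed

lemma lower_central_normal: "lower_central G i \<lhd> G"
proof (induction i)
  case 0
  show ?case by (simp add: normal_inv_iff subgroup_self)
next
  case (Suc i)
  show ?case
  proof (cases "i = 0")
    case True
    then show ?thesis by (simp add: normal_inv_iff subgroup_self)
  next
    case False
    then show ?thesis using commutator_subgroup_normal(1) [OF Suc] by (simp add: lower_central_Suc)
  qed
qed

lemma lower_central_subgroup: "subgroup (lower_central G i) G"
  using lower_central_normal by (rule normal_imp_subgroup)

lemma lower_central_carrier: "lower_central G i \<subseteq> carrier G"
  using lower_central_subgroup by (rule subgroup.subset)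

lemma lower_central_antimono: "i \<le> j \<Longrightarrow> lower_central G j \<subseteq> lower_central G i"
proof (induction rule: dec_induct)
  case (step j)
  have "lower_central G (Suc j) \<subseteq> lower_central G j"
    using commutator_subgroup_normal(2) [OF lower_central_normal [of j]]
    by (cases "j = 0") (simp_all add: lower_central_Suc)
  with step.IH show ?case by blast
qed simp

lemma lower_central_eventually_trivial:
  assumes "lower_central G (Suc c) = {\<one>}" "Suc c \<le> i"
  shows "lower_central G i = {\<one>}"
  using lower_central_antimono [OF assms(2)] subgroup.one_closed [OF lower_central_subgroup] assms(1)
  by auto

lemma commutator_in_lower_central_Suc:
  assumes "x \<in> lower_central G i" "y \<in> carrier G"
  shows "commutator G x y \<in> lower_central G (Suc i)"
proof (cases "i = 0")
  case True
  then show ?thesis using assms by simp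
next
  case False
  then show ?thesis using assms
    by (auto simp: lower_central_Suc commutator_subgroup_def intro!: generate.incl)
qed

text \<open>
  A form of the Hall--Witt identity: modulo \<open>N\<close>, conjugation by \<open>x\<close> sends \<open>[y, z]\<close> to \<open>[c y, e z]\<close> with
  \<open>c = [x, y]\<close> and \<open>e = [x, z]\<close>. Here \<open>c\<close> is central modulo \<open>N\<close>, and \<open>e\<close> commutes modulo \<open>N\<close> with \<open>y\<close> and with
  \<open>z y\<^sup>-\<^sup>1 z\<^sup>-\<^sup>1\<close>, hence with \<open>[y, z]\<close>; so \<open>[c y, e z]\<close> reduces to \<open>[y, z]\<close>.
\<close>

lemma three_element_commutator:
  assumes N: "subgroup N G"
    and carr: "x \<in> carrier G" "y \<in> carrier G" "z \<in> carrier G"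
    and c: "c = commutator G x y" and e: "e = commutator G x z"
    and N1: "\<And>w. w \<in> carrier G \<Longrightarrow> commutator G c w \<in> N"
    and N2: "commutator G e y \<in> N" "commutator G e (z \<otimes> inv y \<otimes> inv z) \<in> N"
    and norm: "\<And>g w. g \<in> carrier G \<Longrightarrow> w \<in> N \<Longrightarrow> g \<otimes> w \<otimes> inv g \<in> N"
  shows "commutator G x (commutator G y z) \<in> N"
proof -
  have cc: "c \<in> carrier G" "e \<in> carrier G" using c e carr by auto
  define w1 where "w1 = commutator G c (commutator G y (e \<otimes> z))"
  define w2 where "w2 = y \<otimes> commutator G e (z \<otimes> inv y \<otimes> inv z) \<otimes> inv y"
  define w3 where "w3 = commutator G y z \<otimes> commutator G c (e \<otimes> z) \<otimes> inv (commutator G y z)"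
  have "w1 \<in> N" unfolding w1_def by (rule N1) (use carr cc in simp)
  moreover have "w2 \<in> N" unfolding w2_def using carr(2) N2(2) by (rule norm)
  moreover have "w3 \<in> N" unfolding w3_def
    by (rule norm [OF _ N1]) (use carr cc in simp_all)
  ultimately have "w1 \<otimes> inv (commutator G e y) \<otimes> (commutator G e y \<otimes> w2) \<otimes> w3 \<in> N" (is "?w \<in> N")
    using N2(1) N by (simp only: subgroup.m_closed subgroup.m_inv_closed)
  also have "?w = commutator G (c \<otimes> y) (e \<otimes> z) \<otimes> inv (commutator G y z)"
    unfolding w1_def w2_def w3_def using carr cc by (simp add: word_simps)
  also have "c \<otimes> y = x \<otimes> y \<otimes> inv x" using carr c by (simp add: word_simps)
  also have "e \<otimes> z = x \<otimes> z \<otimes> inv x" using carr e by (simp add: word_simps)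
  also have "commutator G (x \<otimes> y \<otimes> inv x) (x \<otimes> z \<otimes> inv x) \<otimes> inv (commutator G y z)
      = commutator G x (commutator G y z)"
    using carr by (simp add: word_simps)
  finally show ?thesis .
qed

text \<open>
  Strong centrality. By induction on \<open>j\<close> for all \<open>i\<close> at once: \<open>\<gamma>\<^sub>j\<^sub>+\<^sub>1\<close> is generated by commutators \<open>[h, k]\<close>
  with \<open>h \<in> \<gamma>\<^sub>j\<close>, and for those the Hall--Witt argument reduces \<open>[x, [h, k]]\<close> to the cases \<open>(i, j)\<close> and
  \<open>(i + 1, j)\<close>. The dummy term \<open>\<gamma>\<^sub>0\<close>, the whole group, fits the rule.
\<close>

lemma commutator_in_lower_central_add:
  assumes "x \<in> lower_central G i" "y \<in> lower_central G j"
  shows "commutator G x y \<in> lower_central G (i + j)"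
  using assms
proof (induction j arbitrary: i x y)
  case 0
  then have "commutator G x y \<in> lower_central G (Suc i)"
    by (intro commutator_in_lower_central_Suc) auto
  then show ?case using lower_central_antimono [of i "Suc i"] by auto
next
  case (Suc j)
  show ?case
  proof (cases "j = 0")
    case True
    with Suc.prems show ?thesis by (auto intro: commutator_in_lower_central_Suc)
  next
    case False
    let ?N = "lower_central G (i + Suc j)"
    interpret N: normal ?N G by (rule lower_central_normal)
    have xc: "x \<in> carrier G" using Suc.prems lower_central_carrier by auto
    have y: "y \<in> generate G (\<Union>h\<in>lower_central G j. \<Union>k\<in>carrier G. {commutator G h k})"
      using Suc.prems False by (simp add: lower_central_Suc commutator_subgroup_def)
    show ?thesis
    proof (rule commutator_generate_right [OF lower_central_normal xc _ _ y])
      show "(\<Union>h\<in>lower_central G j. \<Union>k\<in>carrier G. {commutator G h k}) \<subseteq> carrier G"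
        using lower_central_carrier by force
      fix u assume "u \<in> (\<Union>h\<in>lower_central G j. \<Union>k\<in>carrier G. {commutator G h k})"
      then obtain h k where h: "h \<in> lower_central G j" and k: "k \<in> carrier G"
        and u: "u = commutator G h k" by auto
      have hc: "h \<in> carrier G" using h lower_central_carrier by auto
      have e: "commutator G x k \<in> lower_central G (Suc i)"
        using Suc.prems(1) k by (rule commutator_in_lower_central_Suc)
      have c: "commutator G x h \<in> lower_central G (i + j)"
        using Suc.prems(1) h by (rule Suc.IH)
      have h': "k \<otimes> inv h \<otimes> inv k \<in> lower_central G j"
        using h k lower_central_normal by (auto simp: normal_inv_iff subgroup.m_inv_closed)
      show "commutator G x u \<in> ?N"
        unfolding u
      proof (rule three_element_commutator [OF N.subgroup_axioms xc hc k refl refl])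
        show "commutator G (commutator G x h) w \<in> ?N" if "w \<in> carrier G" for w
          using commutator_in_lower_central_Suc [OF c that] by simp
        show "commutator G (commutator G x k) h \<in> ?N"
          using Suc.IH [OF e h] by simp
        show "commutator G (commutator G x k) (k \<otimes> inv h \<otimes> inv k) \<in> ?N"
          using Suc.IH [OF e h'] by simp
      qed (rule N.inv_op_closed2)
    qed
  qed
qed

end

section \<open>Polynomial sequences in a filtered group\<close>

definition difference :: "('a, 'b) monoid_scheme \<Rightarrow> (nat \<Rightarrow> 'a) \<Rightarrow> nat \<Rightarrow> 'a" where
  "difference G f n = inv\<^bsub>G\<^esub> f n \<otimes>\<^bsub>G\<^esub> f (Suc n)"

abbreviation sequence_group :: "('a, 'b) monoid_scheme \<Rightarrow> (nat \<Rightarrow> 'a) monoid" where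
  "sequence_group G \<equiv> product_group UNIV (\<lambda>_. G)"

text \<open>
  Conjugation by \<open>f\<close>, iterated, yields conjugation by every power of \<open>f\<close>, and in a finite group the inverse
  is such a power; so a set invariant under conjugation by \<open>f\<close> is invariant under its inverse too.
\<close>

lemma (in group) conjugate_by_inverse:
  assumes fin: "finite (carrier G)" and f: "\<And>n. f n \<in> carrier G"
    and M: "\<And>x. x \<in> M \<Longrightarrow> (\<lambda>n. f n \<otimes> x n \<otimes> inv f n) \<in> M"
    and carr: "\<And>x n. x \<in> M \<Longrightarrow> x n \<in> carrier G"
    and x: "x \<in> M"
  shows "(\<lambda>n. inv f n \<otimes> x n \<otimes> f n) \<in> M"
proof -
  have xc: "x n \<in> carrier G" for n
    using carr [OF x] .
  have iter: "(\<lambda>n. f n [^] i \<otimes> x n \<otimes> inv (f n [^] i)) \<in> M" for i :: nat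
  proof (induction i)
    case 0
    show ?case using x xc by simp
  next
    case (Suc i)
    have "f n \<otimes> (f n [^] i \<otimes> x n \<otimes> inv (f n [^] i)) \<otimes> inv (f n)
        = f n [^] Suc i \<otimes> x n \<otimes> inv (f n [^] Suc i)" for n
      using f xc unfolding nat_pow_Suc2 [OF f] by (simp add: word_simps del: nat_pow_Suc)
    with M [OF Suc] show ?case by simp
  qed
  have pos: "order G > 0" using fin by (simp add: order_gt_0_iff_finite)
  have "f n [^] (order G - 1) = inv f n" for n
  proof -
    have "f n [^] (order G - 1) \<otimes> f n = f n [^] Suc (order G - 1)"
      by simp
    also have "\<dots> = \<one>" using pos pow_order_eq_1 [OF f] by simp
    finally show ?thesis using f by (intro inv_equality [symmetric]) auto
  qed
  with iter [of "order G - 1"] f show ?thesis by simp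
qed

text \<open>
  Finiteness serves only to pass from conjugation by a sequence to conjugation by its inverse.
\<close>

locale finite_filtered_group = group G for G :: "('a, 'b) monoid_scheme" (structure) +
  fixes F :: "nat \<Rightarrow> 'a set" and N :: nat
  assumes finite_group: "finite (carrier G)"
    and F_subgroup: "subgroup (F i) G"
    and F_Suc: "F (Suc i) \<subseteq> F i"
    and F_commutator: "x \<in> F i \<Longrightarrow> y \<in> F j \<Longrightarrow> commutator G x y \<in> F (i + j)"
    and F_trivial: "F N = {\<one>}"
begin

text \<open>
  Degree shift \<open>t\<close>: the \<open>i\<close>-th difference must lie in \<open>F (t + i)\<close>, so that the difference of a member for
  \<open>t\<close> is a member for \<open>t + 1\<close>. The case \<open>t = 0\<close> is the usual notion.
\<close>

definition polynomial_sequences :: "nat \<Rightarrow> (nat \<Rightarrow> 'a) set" where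
  "polynomial_sequences t = {f. \<forall>i n. (difference G ^^ i) f n \<in> F (t + i)}"

lemma polynomial_sequencesD: "f \<in> polynomial_sequences t \<Longrightarrow> (difference G ^^ i) f n \<in> F (t + i)"
  by (simp add: polynomial_sequences_def)

lemma polynomial_sequences_iff:
  "f \<in> polynomial_sequences t \<longleftrightarrow>
     (\<forall>n. f n \<in> F t) \<and> difference G f \<in> polynomial_sequences (Suc t)"
proof
  assume f: "f \<in> polynomial_sequences t"
  have "f n \<in> F t" for n
    using polynomial_sequencesD [OF f, of 0 n] by simp
  moreover have "(difference G ^^ i) (difference G f) n \<in> F (Suc t + i)" for i n
    using polynomial_sequencesD [OF f, of "Suc i" n]
    by (simp add: funpow_Suc_right del: funpow.simps)
  ultimately show "(\<forall>n. f n \<in> F t) \<and> difference G f \<in> polynomial_sequences (Suc t)"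
    by (simp add: polynomial_sequences_def)
next
  assume f: "(\<forall>n. f n \<in> F t) \<and> difference G f \<in> polynomial_sequences (Suc t)"
  have "(difference G ^^ i) f n \<in> F (t + i)" for i n
  proof (cases i)
    case (Suc k)
    then show ?thesis
      using polynomial_sequencesD [OF conjunct2 [OF f], of k n]
      by (simp add: funpow_Suc_right del: funpow.simps)
  qed (use f in simp)
  then show "f \<in> polynomial_sequences t"
    by (simp add: polynomial_sequences_def)
qed

lemma F_carrier: "x \<in> F i \<Longrightarrow> x \<in> carrier G"
  using F_subgroup subgroup.subset by blast

lemma F_antimono: "i \<le> j \<Longrightarrow> F j \<subseteq> F i"
  using F_Suc by (rule lift_Suc_antimono_le)

lemma F_eventually_trivial: "N \<le> i \<Longrightarrow> F i = {\<one>}"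
  using F_antimono [of N i] F_trivial subgroup.one_closed [OF F_subgroup] by auto

lemma polynomial_sequences_antimono:
  assumes "s \<le> t"
  shows "polynomial_sequences t \<subseteq> polynomial_sequences s"
proof
  fix f assume f: "f \<in> polynomial_sequences t"
  have "(difference G ^^ i) f n \<in> F (s + i)" for i n
    using polynomial_sequencesD [OF f] F_antimono [of "s + i" "t + i"] assms by auto
  then show "f \<in> polynomial_sequences s"
    by (simp add: polynomial_sequences_def)
qed

lemma polynomial_sequence_value: "f \<in> polynomial_sequences t \<Longrightarrow> f n \<in> F t"
  by (simp add: polynomial_sequences_iff [of f t])

lemma polynomial_sequence_carrier: "f \<in> polynomial_sequences t \<Longrightarrow> f n \<in> carrier G"
  by (rule F_carrier, rule polynomial_sequence_value)

lemma one_polynomial_sequence: "(\<lambda>n. \<one>) \<in> polynomial_sequences t"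
proof -
  have "(difference G ^^ i) (\<lambda>n. \<one>) = (\<lambda>n. \<one>)" for i
    by (induction i) (simp_all add: difference_def [abs_def])
  then show ?thesis
    using subgroup.one_closed [OF F_subgroup] by (simp add: polynomial_sequences_def)
qed

lemma polynomial_sequences_trivial: "N \<le> t \<Longrightarrow> polynomial_sequences t = {\<lambda>n. \<one>}"
proof (intro equalityI subsetI)
  fix f assume "N \<le> t" "f \<in> polynomial_sequences t"
  then have "f n = \<one>" for n
    using polynomial_sequence_value [of f t n] F_eventually_trivial [of t] by simp
  then show "f \<in> {\<lambda>n. \<one>}" by auto
qed (simp add: one_polynomial_sequence)

sublocale sequences: group "sequence_group G"
  by simp

lemma sequence_carrier: "f \<in> carrier (sequence_group G) \<longleftrightarrow> (\<forall>n. f n \<in> carrier G)"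
  by (auto simp: PiE_def)

lemma sequence_mult: "f \<otimes>\<^bsub>sequence_group G\<^esub> g = (\<lambda>n. f n \<otimes> g n)"
  by (simp add: restrict_UNIV)

lemma sequence_one: "\<one>\<^bsub>sequence_group G\<^esub> = (\<lambda>n. \<one>)"
  by (simp add: restrict_UNIV)

lemma sequence_inv:
  "(\<And>n. f n \<in> carrier G) \<Longrightarrow> inv\<^bsub>sequence_group G\<^esub> f = (\<lambda>n. inv f n)"
  by (subst inv_product_group) (auto simp: PiE_def restrict_UNIV)

lemma difference_mult:
  assumes "\<And>n. f n \<in> carrier G" "\<And>n. g n \<in> carrier G"
  shows "difference G (\<lambda>n. f n \<otimes> g n) =
    (\<lambda>n. (inv g n \<otimes> difference G f n \<otimes> g n) \<otimes> difference G g n)"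
  using assms by (auto simp: difference_def word_simps)

lemma difference_inv:
  assumes "\<And>n. f n \<in> carrier G"
  shows "difference G (\<lambda>n. inv f n) = (\<lambda>n. f n \<otimes> inv (difference G f n) \<otimes> inv f n)"
  using assms by (auto simp: difference_def word_simps)

text \<open>
  The theorem of Lazard and Leibman that polynomial sequences form a group. The difference of a
  product of \<open>f\<close> and \<open>g\<close> contains the difference of \<open>f\<close> conjugated by \<open>g\<close>, so closure under products needs
  control over commutators, one degree higher up. Both claims are therefore proved together by downward
  induction on the degree \<open>m\<close>, starting from the degree where the filtration is trivial.
\<close>

lemma polynomial_sequences_closed:
  "subgroup (polynomial_sequences m) (sequence_group G) \<and>
   (\<forall>s t. s + t = m \<longrightarrow> (\<forall>f\<in>polynomial_sequences s. \<forall>g\<in>polynomial_sequences t.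
      (\<lambda>n. commutator G (f n) (g n)) \<in> polynomial_sequences m))"
proof (induction "N - m" arbitrary: m rule: less_induct)
  case less
  let ?S = "sequence_group G" and ?P = polynomial_sequences
  have values_comm: "commutator G (f n) (g n) \<in> F (s + t)" if "f \<in> ?P s" "g \<in> ?P t" for f g s t n
    using polynomial_sequence_value [OF that(1)] polynomial_sequence_value [OF that(2)]
    by (rule F_commutator)
  show ?case
  proof (cases "N \<le> m")
    case True
    have "subgroup {\<one>\<^bsub>?S\<^esub>} ?S" by (rule sequences.triv_subgroup)
    then have "subgroup (?P m) ?S"
      by (simp only: sequence_one polynomial_sequences_trivial [OF True])
    moreover have "(\<lambda>n. commutator G (f n) (g n)) \<in> ?P m"
      if "s + t = m" "f \<in> ?P s" "g \<in> ?P t" for f g s t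
      using values_comm [OF that(2,3)] that(1) F_eventually_trivial [OF True] True
      by (simp add: polynomial_sequences_trivial)
    ultimately show ?thesis by blast
  next
    case False
    have sub: "subgroup (?P m') ?S" if "m < m'" for m'
      using less [of m'] that False by auto
    have comm: "(\<lambda>n. commutator G (f n) (g n)) \<in> ?P (s + t)"
      if "m < s + t" "f \<in> ?P s" "g \<in> ?P t" for f g s t
      using less [of "s + t"] that False by auto
    let ?M = "?P (Suc m)"
    have M: "subgroup ?M ?S" by (rule sub) simp
    have mult: "(\<lambda>n. f n \<otimes> g n) \<in> ?M" if "f \<in> ?M" "g \<in> ?M" for f g
      using subgroup.m_closed [OF M that] by (simp only: sequence_mult)
    have inv: "(\<lambda>n. inv f n) \<in> ?M" if "f \<in> ?M" for f
      using subgroup.m_inv_closed [OF M that]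
      by (simp only: sequence_inv polynomial_sequence_carrier [OF that])
    have conj: "(\<lambda>n. f n \<otimes> x n \<otimes> inv f n) \<in> ?M" if f: "f \<in> ?P i" and x: "x \<in> ?M" for f x i
    proof -
      have "f \<in> ?P 0" using f polynomial_sequences_antimono [of 0 i] by auto
      then have "(\<lambda>n. commutator G (f n) (x n)) \<in> ?M" using comm [of 0 "Suc m" f x] x by simp
      from mult [OF this x] show ?thesis
        using polynomial_sequence_carrier [OF f] polynomial_sequence_carrier [OF x]
        by (simp add: word_simps)
    qed
    have conj': "(\<lambda>n. inv f n \<otimes> x n \<otimes> f n) \<in> ?M" if f: "f \<in> ?P i" and x: "x \<in> ?M" for f x i
      using finite_group polynomial_sequence_carrier [OF f] conj [OF f] polynomial_sequence_carrier x
      by (rule conjugate_by_inverse)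
    have "subgroup (?P m) ?S"
    proof (rule sequences.subgroupI)
      show "?P m \<subseteq> carrier ?S" by (simp add: subset_iff PiE_def polynomial_sequence_carrier [of _ m])
      show "?P m \<noteq> {}" using one_polynomial_sequence by auto
      fix f assume f: "f \<in> ?P m"
      note fc = polynomial_sequence_carrier [OF f]
      have df: "difference G f \<in> ?M" using f polynomial_sequences_iff by blast
      show "inv\<^bsub>?S\<^esub> f \<in> ?P m"
        unfolding sequence_inv [OF fc] polynomial_sequences_iff [of _ m] difference_inv [OF fc]
        using conj [OF f inv [OF df]] subgroup.m_inv_closed [OF F_subgroup]
          polynomial_sequence_value [OF f] by auto
      fix g assume g: "g \<in> ?P m"
      note gc = polynomial_sequence_carrier [OF g]
      have dg: "difference G g \<in> ?M" using g polynomial_sequences_iff by blast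
      show "f \<otimes>\<^bsub>?S\<^esub> g \<in> ?P m"
        unfolding sequence_mult polynomial_sequences_iff [of _ m] difference_mult [OF fc gc]
        using mult [OF conj' [OF g df] dg] subgroup.m_closed [OF F_subgroup]
          polynomial_sequence_value [OF f] polynomial_sequence_value [OF g] by auto
    qed
    moreover have "(\<lambda>n. commutator G (f n) (g n)) \<in> ?P m"
      if st: "s + t = m" and f: "f \<in> ?P s" and g: "g \<in> ?P t" for f g s t
    proof -
      let ?c = "\<lambda>f g n. commutator G (f n) (g n)"
      define a where "a = difference G f"
      define b where "b = difference G g"
      have a: "a \<in> ?P (Suc s)" and b: "b \<in> ?P (Suc t)"
        unfolding a_def b_def using f g polynomial_sequences_iff by blast+
      have carr: "f n \<in> carrier G" "g n \<in> carrier G" "a n \<in> carrier G" "b n \<in> carrier G" for n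
        by (fact polynomial_sequence_carrier [OF f] polynomial_sequence_carrier [OF g]
            polynomial_sequence_carrier [OF a] polynomial_sequence_carrier [OF b])+
      have "?c a b \<in> ?P (Suc s + Suc t)" using a b st by (intro comm) simp_all
      then have ab: "?c a b \<in> ?M" using polynomial_sequences_antimono [of "Suc m" "Suc s + Suc t"] st by auto
      have ag: "?c a g \<in> ?M" and fb: "?c f b \<in> ?M"
        using comm [of "Suc s" t, OF _ a g] comm [of s "Suc t", OF _ f b] st by simp_all
      note simps = sequence_mult sequence_inv carr
      have "inv\<^bsub>?S\<^esub> (commutator ?S f g) \<otimes>\<^bsub>?S\<^esub> commutator ?S (f \<otimes>\<^bsub>?S\<^esub> a) (g \<otimes>\<^bsub>?S\<^esub> b) \<in> ?M"
        proof (rule sequences.commutator_perturb [OF M])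
        show "f \<in> carrier ?S" "g \<in> carrier ?S" "a \<in> carrier ?S" "b \<in> carrier ?S"
          by (simp_all only: sequence_carrier carr simp_thms)
        show "commutator ?S a g \<in> ?M" "commutator ?S a b \<in> ?M" "commutator ?S f b \<in> ?M"
          using ag ab fb by (simp_all only: simps)
        fix x assume "x \<in> ?M"
        then show "f \<otimes>\<^bsub>?S\<^esub> x \<otimes>\<^bsub>?S\<^esub> inv\<^bsub>?S\<^esub> f \<in> ?M"
          "inv\<^bsub>?S\<^esub> f \<otimes>\<^bsub>?S\<^esub> x \<otimes>\<^bsub>?S\<^esub> f \<in> ?M"
          "g \<otimes>\<^bsub>?S\<^esub> x \<otimes>\<^bsub>?S\<^esub> inv\<^bsub>?S\<^esub> g \<in> ?M"
          "inv\<^bsub>?S\<^esub> g \<otimes>\<^bsub>?S\<^esub> x \<otimes>\<^bsub>?S\<^esub> g \<in> ?M"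
          using conj [OF f] conj' [OF f] conj [OF g] conj' [OF g] by (simp_all only: simps)
      qed
      moreover have "f n \<otimes> a n = f (Suc n)" "g n \<otimes> b n = g (Suc n)" for n
        using carr by (simp_all add: a_def b_def difference_def word_simps)
      ultimately have "difference G (?c f g) \<in> ?M"
        using carr by (simp only: simps difference_def [abs_def] m_closed inv_closed)
      then show ?thesis
        using values_comm [OF f g] st by (simp add: polynomial_sequences_iff [of _ m])
    qed
    ultimately show ?thesis by blast
  qed
qed

lemma polynomial_sequence_mult:
  "f \<in> polynomial_sequences t \<Longrightarrow> g \<in> polynomial_sequences t \<Longrightarrow>
     (\<lambda>n. f n \<otimes> g n) \<in> polynomial_sequences t"
  using subgroup.m_closed [OF conjunct1 [OF polynomial_sequences_closed [of t]], of f g]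
  by (simp only: sequence_mult)

text \<open>
  By Pascal's rule, taking the difference lowers \<open>j\<close> by one; these sequences are the monomials of the
  Taylor expansion.
\<close>

lemma binomial_polynomial_sequence:
  "w \<in> F (t + j) \<Longrightarrow> (\<lambda>n. w [^] (n choose j)) \<in> polynomial_sequences t"
proof (induction j arbitrary: t)
  case 0
  then have "w \<in> carrier G" using F_carrier by auto
  then have "difference G (\<lambda>n. w [^] (n choose 0)) = (\<lambda>n. \<one>)"
    by (simp add: difference_def [abs_def])
  with 0 show ?case
    using one_polynomial_sequence F_carrier by (simp add: polynomial_sequences_iff [of _ t])
next
  case (Suc j)
  then have w: "w \<in> carrier G" using F_carrier by auto
  have "inv (w [^] (n choose Suc j)) \<otimes> w [^] (Suc n choose Suc j) = w [^] (n choose j)" for n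
    using w by (simp add: nat_pow_mult [symmetric] add.commute [of "n choose j"] inv_mult_cancel)
  then have diff: "difference G (\<lambda>n. w [^] (n choose Suc j)) = (\<lambda>n. w [^] (n choose j))"
    by (simp only: difference_def [abs_def])
  have "w \<in> F t" using Suc.prems F_antimono [of t "t + Suc j"] by auto
  then have "w [^] k \<in> F t" for k :: nat
    using subgroup_int_pow_closed [OF F_subgroup, of w t "int k"] by (simp add: int_pow_int)
  with diff Suc show ?case
    by (simp add: polynomial_sequences_iff [of _ t])
qed

text \<open>
  The first value that is not yet forced to be trivial equals the top difference at 0, and so lies as deep
  in the filtration as that difference; this is what makes it a legitimate Taylor coefficient.
\<close>

lemma first_nontrivial_value:
  "f \<in> polynomial_sequences t \<Longrightarrow> (\<And>i. i < m \<Longrightarrow> f i = \<one>) \<Longrightarrow> f m \<in> F (t + m)"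
proof (induction m arbitrary: f t)
  case 0
  then show ?case using polynomial_sequence_value [of f t 0] by simp
next
  case (Suc m)
  have "difference G f m \<in> F (Suc t + m)"
  proof (rule Suc.IH)
    show "difference G f \<in> polynomial_sequences (Suc t)"
      using Suc.prems polynomial_sequences_iff by blast
    show "difference G f i = \<one>" if "i < m" for i
      using that Suc.prems(2) by (simp add: difference_def)
  qed
  moreover have "difference G f m = f (Suc m)"
    using Suc.prems(2) [of m] polynomial_sequence_carrier [OF Suc.prems(1)] by (simp add: difference_def)
  ultimately show ?case by simp
qed

text \<open>
  Taylor expansion in disguise: dividing \<open>f\<close> on the left by one monomial after the other makes it trivial
  at \<open>0, \<dots>, m - 1\<close> without changing the value at \<open>n\<close>, since by hypothesis the monomials are trivial at \<open>n\<close>. Once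
  \<open>m = n\<close>, the value at \<open>n\<close> is itself the next coefficient, an element of \<open>F n\<close>.
\<close>

lemma polynomial_sequence_vanishes:
  assumes f: "f \<in> polynomial_sequences 0" and f0: "f 0 = \<one>"
    and pow: "\<And>j w. 1 \<le> j \<Longrightarrow> j \<le> n \<Longrightarrow> w \<in> F j \<Longrightarrow> w [^] (n choose j) = \<one>"
  shows "f n = \<one>"
proof (cases "n = 0")
  case False
  have "1 \<le> m \<Longrightarrow> m \<le> n \<Longrightarrow> \<exists>g\<in>polynomial_sequences 0. (\<forall>i<m. g i = \<one>) \<and> g n = f n" for m
  proof (induction m rule: dec_induct)
    case base
    show ?case using f f0 by auto
  next
    case (step m)
    then obtain g where g: "g \<in> polynomial_sequences 0" "\<And>i. i < m \<Longrightarrow> g i = \<one>" "g n = f n"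
      by auto
    define w where "w = inv g m"
    have gm: "g m \<in> F m" using first_nontrivial_value [OF g(1,2)] by simp
    then have w: "w \<in> F m"
      unfolding w_def by (rule subgroup.m_inv_closed [OF F_subgroup])
    have carr: "g i \<in> carrier G" "w \<in> carrier G" for i
      using polynomial_sequence_carrier [OF g(1)] w F_carrier by auto
    define h where "h = (\<lambda>i. w [^] (i choose m) \<otimes> g i)"
    have "h \<in> polynomial_sequences 0"
      unfolding h_def using w g(1)
      by (intro polynomial_sequence_mult binomial_polynomial_sequence) auto
    moreover have "h i = \<one>" if "i < Suc m" for i
      using that g(2) carr by (cases "i = m") (auto simp: h_def w_def binomial_eq_0)
    moreover have "h n = f n"
      using pow [OF _ _ w] step.hyps step.prems carr(1) [of n] g(3) by (simp add: h_def)
    ultimately show ?case by blast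
  qed
  from this [of n] False obtain g where g: "g \<in> polynomial_sequences 0" "\<And>i. i < n \<Longrightarrow> g i = \<one>" "g n = f n"
    by auto
  have "g n \<in> F n" using first_nontrivial_value [OF g(1,2)] by simp
  then have "g n [^] (n choose n) = \<one>" using False by (intro pow) auto
  then show ?thesis using g(3) polynomial_sequence_carrier [OF g(1), of n] by simp
qed (simp add: f0)

end

section \<open>Witness products\<close>

context group
begin

lemma witness_product_0: "witness_product G x k 0 = \<one>"
  by (simp add: witness_product_def)

lemma witness_product_Suc:
  "witness_product G x k (Suc n) = x \<otimes> k [^] n \<otimes> witness_product G x k n"
proof -
  have "[1..<Suc (Suc n)] = 1 # map Suc [1..<Suc n]"
    by (simp only: map_Suc_upt upt_conv_Cons)
  then show ?thesis
    by (simp add: witness_product_def comp_def del: upt_Suc)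
qed

lemma witness_product_closed:
  "x \<in> carrier G \<Longrightarrow> k \<in> carrier G \<Longrightarrow> witness_product G x k n \<in> carrier G"
  by (induction n) (simp_all add: witness_product_0 witness_product_Suc)

text \<open>
  The witness product read as a sequence: its length varies while the factors stay the same, whereas in
  \<^const>\<open>witness_product\<close> all exponents move with the length.
\<close>

fun left_product :: "'a \<Rightarrow> 'a \<Rightarrow> nat \<Rightarrow> 'a" where
  "left_product x k 0 = \<one>"
| "left_product x k (Suc n) = left_product x k n \<otimes> (x \<otimes> inv k [^] Suc n)"

lemma left_product_closed:
  "x \<in> carrier G \<Longrightarrow> k \<in> carrier G \<Longrightarrow> left_product x k n \<in> carrier G"
  by (induction n) simp_all

lemma witness_product_eq_left_product:
  assumes "x \<in> carrier G" "k \<in> carrier G" "k [^] n = \<one>"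
  shows "witness_product G x k n = left_product x k n"
proof -
  have app: "foldr (\<otimes>) xs y = foldr (\<otimes>) xs \<one> \<otimes> y \<and> foldr (\<otimes>) xs \<one> \<in> carrier G"
    if "set xs \<subseteq> carrier G" "y \<in> carrier G" for xs y
    using that by (induction xs) (auto simp: m_assoc)
  have "foldr (\<otimes>) (map (\<lambda>i. x \<otimes> k [^] (n - i)) [1..<Suc m]) \<one> = left_product x k m" if "m \<le> n" for m
    using that
  proof (induction m)
    case (Suc m)
    have "k [^] (n - Suc m) \<otimes> k [^] Suc m = \<one>"
      using nat_pow_mult [OF assms(2), of "n - Suc m" "Suc m"] assms(3) Suc.prems
      by (simp del: nat_pow_Suc)
    then have "k [^] (n - Suc m) = inv k [^] Suc m"
      using assms by (subst nat_pow_inv) (auto intro!: inv_equality [symmetric] simp del: nat_pow_Suc)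
    let ?xs = "map (\<lambda>i. x \<otimes> k [^] (n - i)) [1..<Suc m]"
    have "foldr (\<otimes>) (map (\<lambda>i. x \<otimes> k [^] (n - i)) [1..<Suc (Suc m)]) \<one>
        = foldr (\<otimes>) ?xs (x \<otimes> k [^] (n - Suc m))"
      using assms by simp
    also have "\<dots> = foldr (\<otimes>) ?xs \<one> \<otimes> (x \<otimes> k [^] (n - Suc m))"
      using assms by (intro conjunct1 [OF app]) auto
    also have "foldr (\<otimes>) ?xs \<one> = left_product x k m"
      using Suc by simp
    finally show ?case
      by (simp only: \<open>k [^] (n - Suc m) = inv k [^] Suc m\<close> left_product.simps)
  qed simp
  then show ?thesis by (simp add: witness_product_def)
qed

text \<open>
  Right multiplication by \<open>k\<close> splits the group into cycles of length \<open>n = ord k\<close>. On the element \<open>r k\<^sup>i\<close> of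
  the cycle through a chosen representative \<open>r\<close>, with \<open>i < n\<close>, let \<open>f\<close> be the witness product of length \<open>i\<close>
  at \<open>r\<close>; the rule \<open>f (x k) = x f x\<close> is then its recursion in \<open>i\<close>, and at the end of the cycle it says that the
  witness product of length \<open>n\<close> is trivial.
\<close>

lemma J_group_if_witness:
  assumes "k \<in> witnesses G"
  shows "J_group G"
proof -
  let ?n = "ord k"
  have k: "k \<in> carrier G" and pos: "0 < ?n"
    and wit: "\<And>x. x \<in> carrier G \<Longrightarrow> witness_product G x k ?n = \<one>"
    using assms by (auto simp: witnesses_def)
  define r where "r x = (SOME y. y \<in> carrier G \<and> (\<exists>i::nat. x = y \<otimes> k [^] i))" for x
  define e where "e x = (LEAST i::nat. x = r x \<otimes> k [^] i)" for x
  have r: "r x \<in> carrier G \<and> (\<exists>i::nat. x = r x \<otimes> k [^] i)" if "x \<in> carrier G" for x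
    unfolding r_def by (rule someI [of _ x]) (use that in \<open>auto intro: exI [of _ 0]\<close>)
  have e: "x = r x \<otimes> k [^] e x" if "x \<in> carrier G" for x
    unfolding e_def by (rule LeastI_ex) (use r [OF that] in blast)
  have e_unique: "e x = i" if x: "x \<in> carrier G" and i: "i < ?n" "x = r x \<otimes> k [^] i" for x i
  proof -
    have "e x \<le> i" unfolding e_def using i(2) by (rule Least_le)
    moreover have "k [^] e x = k [^] i"
    proof -
      have "r x \<otimes> k [^] e x = r x \<otimes> k [^] i" using e [OF x] i(2) by simp
      then show ?thesis using r [OF x] k by (simp only: l_cancel nat_pow_closed)
    qed
    ultimately show ?thesis
      using i(1) by (intro inj_onD [OF ord_inj [OF k]]) auto
  qed
  have pow_mod: "k [^] (i mod ?n) = k [^] i" for i :: nat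
  proof -
    have "k [^] i = k [^] (?n * (i div ?n) + i mod ?n)" by simp
    also have "\<dots> = (k [^] ?n) [^] (i div ?n) \<otimes> k [^] (i mod ?n)"
      using k by (simp only: nat_pow_mult nat_pow_pow)
    also have "\<dots> = k [^] (i mod ?n)"
      using k by (simp add: pow_ord_eq_1)
    finally show ?thesis by simp
  qed
  have e_less: "e x < ?n" if x: "x \<in> carrier G" for x
  proof -
    have "x = r x \<otimes> k [^] (e x mod ?n)"
      using e [OF x] pow_mod [of "e x"] by simp
    then have "e x \<le> e x mod ?n" unfolding e_def by (rule Least_le)
    also have "\<dots> < ?n" using pos by simp
    finally show ?thesis .
  qed
  have r_mult: "r (x \<otimes> k) = r x" if x: "x \<in> carrier G" for x
  proof -
    have "(\<exists>i::nat. x \<otimes> k = y \<otimes> k [^] i) \<longleftrightarrow> (\<exists>i::nat. x = y \<otimes> k [^] i)" if y: "y \<in> carrier G" for y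
    proof
      assume "\<exists>i::nat. x \<otimes> k = y \<otimes> k [^] i"
      then obtain i :: nat where i: "x \<otimes> k = y \<otimes> k [^] i" by blast
      have "x \<otimes> k \<otimes> k [^] (?n - 1) = x"
        using x k pos by (simp add: m_assoc nat_pow_Suc2 [symmetric])
      then have "x = y \<otimes> k [^] (i + (?n - 1))"
        using i y k by (simp add: m_assoc nat_pow_mult)
      then show "\<exists>i::nat. x = y \<otimes> k [^] i" by blast
    next
      assume "\<exists>i::nat. x = y \<otimes> k [^] i"
      then obtain i :: nat where "x = y \<otimes> k [^] i" by blast
      then have "x \<otimes> k = y \<otimes> k [^] Suc i" using y k by (simp add: m_assoc)
      then show "\<exists>i::nat. x \<otimes> k = y \<otimes> k [^] i" by blast
    qed
    then have "(\<lambda>y. y \<in> carrier G \<and> (\<exists>i::nat. x \<otimes> k = y \<otimes> k [^] i))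
        = (\<lambda>y. y \<in> carrier G \<and> (\<exists>i::nat. x = y \<otimes> k [^] i))" by blast
    then show ?thesis by (simp add: r_def)
  qed
  define f where "f x = witness_product G (r x) k (e x)" for x
  have "f \<in> carrier G \<rightarrow> carrier G"
    using r k by (auto simp: f_def witness_product_closed)
  moreover have "f (x \<otimes> k) = x \<otimes> f x" if x: "x \<in> carrier G" for x
  proof -
    have step: "x \<otimes> f x = witness_product G (r x) k (Suc (e x))"
      using e [OF x] by (simp add: f_def witness_product_Suc)
    have xk: "x \<otimes> k = r (x \<otimes> k) \<otimes> k [^] Suc (e x)"
      using e [OF x] r [OF x] k by (simp add: r_mult [OF x] m_assoc [symmetric])
    have xkc: "x \<otimes> k \<in> carrier G" using x k by simp
    show ?thesis
    proof (cases "Suc (e x) = ?n")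
      case True
      then have "x \<otimes> k = r (x \<otimes> k) \<otimes> k [^] (0::nat)"
        using xk k by (simp add: pow_ord_eq_1 del: nat_pow_Suc)
      then have "e (x \<otimes> k) = 0" using pos xkc e_unique by blast
      then have "f (x \<otimes> k) = \<one>" by (simp add: f_def witness_product_0)
      with step True wit r [OF x] show ?thesis by simp
    next
      case False
      then have "Suc (e x) < ?n" using e_less [OF x] by simp
      then have "e (x \<otimes> k) = Suc (e x)" using xkc xk e_unique by blast
      with step show ?thesis by (simp add: f_def r_mult [OF x])
    qed
  qed
  ultimately show ?thesis
    unfolding J_group_def using is_group k by blast
qed

text \<open>
  The polynomial argument, free of any arithmetic of \<open>n\<close>: it isolates the powers that must vanish.
  Degrees 1 and 2 involve arbitrary elements, since \<open>x\<close> and \<open>k\<close> sit there; all higher degrees only involve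
  \<open>\<gamma>\<^sub>d\<^sub>+\<^sub>1\<close>.
\<close>

lemma witness_product_trivial:
  assumes fin: "finite (carrier G)" and c: "lower_central G (Suc c) = {\<one>}"
    and x: "x \<in> carrier G" and k: "k \<in> lower_central G d" and kn: "k [^] n = \<one>"
    and small: "\<And>j w. j \<in> {1, 2} \<Longrightarrow> w \<in> carrier G \<Longrightarrow> w [^] (n choose j) = \<one>"
    and large: "\<And>j w. 3 \<le> j \<Longrightarrow> j \<le> 2 * c \<Longrightarrow> w \<in> lower_central G (Suc d) \<Longrightarrow> w [^] (n choose j) = \<one>"
  shows "witness_product G x k n = \<one>"
proof -
  let ?L = "lower_central G"
  have kc: "k \<in> carrier G" using k lower_central_carrier by auto
  define A where "A = {x, k} \<union> ?L (Suc d)"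
  define K where "K = generate G A"
  \<comment> \<open>Rounding \<open>j / 2\<close> up rather than down leaves room in degree 2 for an element \<open>k\<close> outside \<open>\<gamma>\<^sub>2\<close>.\<close>
  define F where "F j = (if j \<le> 2 then K else ?L (Suc d) \<inter> ?L (Suc j div 2))" for j :: nat
  have A: "A \<subseteq> carrier G" using x kc lower_central_carrier by (auto simp: A_def)
  have K: "subgroup K G" unfolding K_def using A by (rule generate_is_subgroup)
  have K_incl: "A \<subseteq> K" unfolding K_def by (auto intro: generate.incl)
  have comm_A: "commutator G a b \<in> ?L (Suc d)" if a: "a \<in> A" and b: "b \<in> A" for a b
  proof -
    have L: "subgroup (?L (Suc d)) G" by (rule lower_central_subgroup)
    have deep: "commutator G u v \<in> ?L (Suc d)" if "u \<in> ?L d" "v \<in> carrier G" for u v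
      using that by (rule commutator_in_lower_central_Suc)
    have deep': "commutator G v u \<in> ?L (Suc d)" if "u \<in> ?L d" "v \<in> carrier G" for u v
      using commutator_swap [OF L _ _ deep] that lower_central_carrier by blast
    have "a = x \<or> a \<in> ?L d" "b = x \<or> b \<in> ?L d"
      using a b k lower_central_antimono [of d "Suc d"] by (auto simp: A_def)
    moreover have "commutator G x x \<in> ?L (Suc d)"
      using subgroup.one_closed [OF L] x by (simp add: word_simps)
    ultimately show ?thesis using deep deep' a b A by blast
  qed
  have F_K: "F j \<subseteq> K" for j
    using K_incl by (auto simp: F_def A_def)
  have F_L: "F j \<subseteq> ?L (Suc j div 2)" for j
  proof (cases "j \<le> 2")
    case True
    then have "j = 0 \<or> j = 1 \<or> j = 2" by auto
    then have "?L (Suc j div 2) = carrier G" by auto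
    then show ?thesis using True subgroup.subset [OF K] by (simp add: F_def)
  qed (simp add: F_def)
  have F_sub: "subgroup (F i) G" for i
    unfolding F_def by (simp add: K subgroups_Inter_pair lower_central_subgroup)
  interpret finite_filtered_group G F "2 * c + 3"
  proof (intro finite_filtered_group.intro finite_filtered_group_axioms.intro)
    show "group G" by (rule is_group)
    show "finite (carrier G)" by (rule fin)
    show "subgroup (F i) G" for i by (rule F_sub)
    show "F (Suc i) \<subseteq> F i" for i
      using F_K [of "Suc i"]
        lower_central_antimono [OF div_le_mono [of "Suc i" "Suc (Suc i)" 2]]
      by (auto simp: F_def)
    have "F (2 * c + 3) \<subseteq> lower_central G (Suc (2 * c + 3) div 2)"
      by (rule F_L)
    also have "\<dots> = {\<one>}"
      using c by (rule lower_central_eventually_trivial) simp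
    finally show "F (2 * c + 3) = {\<one>}"
      using subgroup.one_closed [OF F_sub [of "2 * c + 3"]] by blast
    fix u v i j assume u: "u \<in> F i" and v: "v \<in> F j"
    have uv: "commutator G u v \<in> ?L (Suc d)"
      using lower_central_normal A comm_A
      by (rule commutator_generate_generate) (use u v F_K in \<open>auto simp: K_def\<close>)
    have "commutator G u v \<in> ?L (Suc i div 2 + Suc j div 2)"
      using u v F_L by (intro commutator_in_lower_central_add) auto
    moreover have "Suc (i + j) div 2 \<le> Suc i div 2 + Suc j div 2" by presburger
    ultimately have "commutator G u v \<in> ?L (Suc (i + j) div 2)"
      using lower_central_antimono by blast
    with uv show "commutator G u v \<in> F (i + j)"
      using K_incl by (auto simp: F_def A_def)
  qed
  have xF: "x \<in> F (1 + 0)" and kF: "inv k \<in> F (1 + 0)" "inv k \<in> F (1 + 1)"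
    using K_incl subgroup.m_inv_closed [OF K] by (auto simp: F_def A_def)
  have poly: "left_product x k \<in> polynomial_sequences 0"
  proof -
    \<comment> \<open>The difference \<open>x k\<^sup>-\<^sup>(\<^sup>n\<^sup>+\<^sup>1\<^sup>)\<close> as a product of monomials of degree 0, 0 and 1, after the degree shift 1.\<close>
    have "(\<lambda>n. x [^] (n choose 0) \<otimes> (inv k [^] (n choose 0) \<otimes> inv k [^] (n choose 1)))
        \<in> polynomial_sequences 1"
      by (intro polynomial_sequence_mult binomial_polynomial_sequence xF kF)
    also have "(\<lambda>n. x [^] (n choose 0) \<otimes> (inv k [^] (n choose 0) \<otimes> inv k [^] (n choose 1)))
        = difference G (left_product x k)"
      using x kc left_product_closed [OF x kc]
      by (simp add: difference_def [abs_def] inv_mult_cancel nat_pow_Suc2 [symmetric] del: nat_pow_Suc)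
    finally have diff: "difference G (left_product x k) \<in> polynomial_sequences 1" .
    have "left_product x k n \<in> K" for n
    proof (induction n)
      case (Suc n)
      have "inv k \<in> K" "x \<in> K" using kF xF by (simp_all add: F_def)
      then have "inv k [^] Suc n \<in> K" for n
        using subgroup_int_pow_closed [OF K, of "inv k" "int (Suc n)"] by (simp only: int_pow_int)
      with Suc \<open>x \<in> K\<close> show ?case by (simp add: subgroup.m_closed [OF K] del: nat_pow_Suc)
    qed (simp add: subgroup.one_closed [OF K])
    with diff show ?thesis
      by (subst polynomial_sequences_iff) (simp add: F_def)
  qed
  have pow: "w [^] (n choose j) = \<one>" if j: "1 \<le> j" and w: "w \<in> F j" for j w
  proof -
    have wc: "w \<in> carrier G" using w F_carrier by blast
    consider "j \<in> {1, 2}" | "3 \<le> j" "j \<le> 2 * c" | "3 \<le> j" "2 * c < j"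
      using j by fastforce
    then show ?thesis
    proof cases
      case 1
      then show ?thesis using wc by (rule small)
    next
      case 2
      then show ?thesis using w by (intro large) (auto simp: F_def)
    next
      case 3
      then have "Suc c \<le> Suc j div 2" by simp
      then have "w = \<one>" using F_L [of j] w lower_central_antimono c by blast
      then show ?thesis by simp
    qed
  qed
  have "left_product x k n = \<one>"
    by (rule polynomial_sequence_vanishes [OF poly _ pow]) simp_all
  then show ?thesis using witness_product_eq_left_product [OF x kc kn] by simp
qed

end

section \<open>Binomial coefficients of prime powers\<close>

text \<open>
  This and the next lemma read off divisibility from
  \<open>j * (n choose j) = n * ((n - 1) choose (j - 1))\<close>: the coefficient can only lose the power of \<open>p\<close> in \<open>j\<close>,
  which is trivial for \<open>j < p\<close> and at most \<open>p\<close> itself for \<open>j < p\<^sup>2\<close>.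
\<close>

lemma prime_power_dvd_binomial:
  fixes p :: nat
  assumes p: "Factorial_Ring.prime p" and j: "0 < j" "j < p"
  shows "p ^ e dvd (p ^ e choose j)"
proof -
  have "j * (p ^ e choose j) = p ^ e * ((p ^ e - 1) choose (j - 1))"
    using j times_binomial_minus1_eq by simp
  then have "p ^ e dvd j * (p ^ e choose j)" by simp
  moreover have "coprime (p ^ e) j"
    using p j by (metis coprime_commute coprime_power_right_iff nat_dvd_not_less prime_imp_coprime)
  ultimately show ?thesis by (simp add: coprime_dvd_mult_right_iff)
qed

lemma prime_power_dvd_binomial_Suc:
  fixes p :: nat
  assumes p: "Factorial_Ring.prime p" and j: "0 < j" "j < p ^ 2"
  shows "p ^ e dvd (p ^ Suc e choose j)"
proof -
  have eq: "j * (p ^ Suc e choose j) = p ^ Suc e * ((p ^ Suc e - 1) choose (j - 1))"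
    using j times_binomial_minus1_eq by simp
  show ?thesis
  proof (cases "p dvd j")
    case False
    then have "coprime (p ^ e) j" using p by (simp add: prime_imp_coprime)
    moreover have "p ^ e dvd j * (p ^ Suc e choose j)" unfolding eq by simp
    ultimately show ?thesis by (simp add: coprime_dvd_mult_right_iff)
  next
    case True
    then obtain u where u: "j = p * u" by blast
    have p0: "0 < p" using p by (rule prime_gt_0_nat)
    have "u < p" "0 < u" using j u p0 by (auto simp: power2_eq_square)
    then have "coprime (p ^ e) u"
      using p by (metis coprime_commute coprime_power_right_iff nat_dvd_not_less prime_imp_coprime)
    moreover have "u * (p ^ Suc e choose j) = p ^ e * ((p ^ Suc e - 1) choose (j - 1))"
    proof -
      have "p * (u * (p ^ Suc e choose j)) = p * (p ^ e * ((p ^ Suc e - 1) choose (j - 1)))"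
        using eq unfolding u by (simp add: mult.assoc)
      then show ?thesis using p0 by (simp only: mult_cancel1) auto
    qed
    then have "p ^ e dvd u * (p ^ Suc e choose j)" by simp
    ultimately show ?thesis by (simp add: coprime_dvd_mult_right_iff)
  qed
qed

section \<open>Exponents and big elements\<close>

lemma (in group) pow_eq_one_if_dvd:
  assumes "x \<in> carrier G" "x [^] (m::nat) = \<one>" "m dvd n"
  shows "x [^] n = \<one>"
  using assms by (auto simp: nat_pow_pow [symmetric] elim!: dvdE)

lemma (in group) group_exponent_pow:
  assumes "x \<in> carrier G"
  shows "x [^] group_exponent G = \<one>"
  using assms by (simp add: pow_eq_id group_exponent_def)

lemma (in group) pow_group_exponent_dvd:
  assumes "\<And>x. x \<in> carrier G \<Longrightarrow> x [^] (n::nat) = \<one>"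
  shows "group_exponent G dvd n"
  using assms by (auto simp: group_exponent_def Lcm_dvd_iff pow_eq_id [symmetric])

lemma (in group) ord_subgroup:
  assumes "subgroup H G" "x \<in> H"
  shows "group.ord (G\<lparr>carrier := H\<rparr>) x = ord x"
proof -
  interpret H: group "G\<lparr>carrier := H\<rparr>" using assms(1) by (rule subgroup_imp_group)
  have "x \<in> carrier G" using assms subgroup.subset by blast
  then have iff: "H.ord x dvd n \<longleftrightarrow> ord x dvd n" for n
    using assms(2) nat_pow_consistent [of x _ H] by (simp add: pow_eq_id [symmetric] H.pow_eq_id [symmetric])
  show ?thesis using iff [of "ord x"] iff [of "H.ord x"] by (simp add: dvd_antisym)
qed

lemma (in group) group_exponent_subgroup_dvd:
  assumes H: "subgroup H G" and K: "subgroup K G" and "H \<subseteq> K"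
  shows "group_exponent (G\<lparr>carrier := H\<rparr>) dvd group_exponent (G\<lparr>carrier := K\<rparr>)"
proof -
  have "group.ord (G\<lparr>carrier := H\<rparr>) ` H = ord ` H" "group.ord (G\<lparr>carrier := K\<rparr>) ` K = ord ` K"
    using ord_subgroup H K by auto
  then show ?thesis
    using assms(3) by (auto simp: group_exponent_def intro!: Lcm_subset)
qed

text \<open>
  The orders are powers of \<open>p\<close>, hence form a chain under divisibility, and their least common multiple is
  the largest of them.
\<close>

lemma (in group) prime_power_group_big_element:
  assumes p: "Factorial_Ring.prime p" and a: "order G = p ^ a"
  obtains x where "x \<in> big_elements G"
proof -
  have fin: "finite (carrier G)"
    using a p prime_gt_0_nat order_gt_0_iff_finite by simp
  have pow: "\<exists>i. ord x = p ^ i" if "x \<in> carrier G" for x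
    using ord_dvd_group_order [OF that] a p by (auto simp: divides_primepow_nat)
  have "Max (ord ` carrier G) \<in> ord ` carrier G"
    using fin carrier_not_empty by (intro Max_in) auto
  then obtain x where x: "x \<in> carrier G" "ord x = Max (ord ` carrier G)" by auto
  have "ord y dvd ord x" if y: "y \<in> carrier G" for y
  proof -
    obtain i j where ij: "ord x = p ^ i" "ord y = p ^ j" using pow x(1) y by blast
    have "ord y \<le> ord x" unfolding x(2) using fin y by simp
    then have "j \<le> i" using ij p prime_gt_1_nat by simp
    then show ?thesis using ij by (simp add: le_imp_power_dvd)
  qed
  then have "group_exponent G = ord x"
    unfolding group_exponent_def
    using x(1) by (intro dvd_antisym Lcm_least dvd_Lcm) auto
  with x(1) show thesis by (intro that [of x]) (simp add: big_elements_def)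
qed

text \<open>
  The depth is a genuine maximum: the terms from index \<open>c + 1\<close> on are trivial and have exponent 1, which
  differs from the exponent of the group, so the admissible indices are bounded.
\<close>

lemma (in group) exponent_depth_maximal:
  assumes c: "lower_central G (Suc c) = {\<one>}" and nontriv: "group_exponent G \<noteq> 1"
  shows "group_exponent (lower_central_group G (exponent_depth G)) = group_exponent G"
    and "group_exponent (lower_central_group G (Suc (exponent_depth G))) \<noteq> group_exponent G"
proof -
  let ?P = "\<lambda>d. 1 \<le> d \<and> group_exponent (lower_central_group G d) = group_exponent G"
  have trivial_exponent: "group_exponent (G\<lparr>carrier := {\<one>}\<rparr>) = 1"
    using ord_subgroup [OF triv_subgroup] by (simp add: group_exponent_def)
  have "carrier G \<noteq> {\<one>}"
    using nontriv by (auto simp: group_exponent_def)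
  then have depth: "exponent_depth G = (GREATEST d. ?P d)"
    by (simp add: exponent_depth_def)
  have bound: "d \<le> c" if "?P d" for d
  proof (rule ccontr)
    assume "\<not> d \<le> c"
    then have "lower_central G d = {\<one>}" using lower_central_eventually_trivial [OF c] by simp
    with that trivial_exponent nontriv show False by simp
  qed
  have "?P 1" by simp
  then have P: "?P (exponent_depth G)"
    unfolding depth using bound by (rule GreatestI_nat)
  then show "group_exponent (lower_central_group G (exponent_depth G)) = group_exponent G" by simp
  have "\<not> ?P (Suc (exponent_depth G))"
  proof
    assume "?P (Suc (exponent_depth G))"
    then have "Suc (exponent_depth G) \<le> exponent_depth G"
      unfolding depth using bound by (rule Greatest_le_nat)
    then show False by simp
  qed
  then show "group_exponent (lower_central_group G (Suc (exponent_depth G))) \<noteq> group_exponent G"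
    by simp
qed

section \<open>Big elements are witnesses\<close>

text \<open>
  The common core of (a) and (b): degrees below \<open>p\<close> are harmless because \<open>p\<^sup>e\<close> divides the binomial
  coefficient, and what is left to check are the degrees from \<open>p\<close> to \<open>2 c\<close> on \<open>\<gamma>\<^sub>d\<^sub>+\<^sub>1\<close>. Oddness of \<open>p\<close> puts
  the degrees 1 and 2 below \<open>p\<close>.
\<close>

lemma (in group) prime_power_witness:
  assumes p: "Factorial_Ring.prime p" "odd p" and fin: "finite (carrier G)"
    and c: "lower_central G (Suc c) = {\<one>}"
    and k: "k \<in> lower_central G d" and ord_k: "ord k = p ^ e"
    and exponent: "\<And>w. w \<in> carrier G \<Longrightarrow> w [^] (p ^ e) = \<one>"
    and large: "\<And>j w. p \<le> j \<Longrightarrow> j \<le> 2 * c \<Longrightarrow> w \<in> lower_central G (Suc d) \<Longrightarrow>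
      w [^] (p ^ e choose j) = \<one>"
  shows "k \<in> witnesses G"
proof -
  have kc: "k \<in> carrier G" using k lower_central_carrier by blast
  have p3: "3 \<le> p" using p prime_ge_2_nat [of p] by (cases "p = 2") auto
  have small: "w [^] (p ^ e choose j) = \<one>" if "0 < j" "j < p" "w \<in> carrier G" for j w
    using that prime_power_dvd_binomial [OF p(1)] by (intro pow_eq_one_if_dvd [OF _ exponent]) auto
  have "witness_product G x k (p ^ e) = \<one>" if x: "x \<in> carrier G" for x
  proof (rule witness_product_trivial [OF fin c x k])
    show "k [^] (p ^ e) = \<one>" using kc by (rule exponent)
    show "w [^] (p ^ e choose j) = \<one>" if "j \<in> {1, 2}" "w \<in> carrier G" for j w
      using that p3 by (intro small) auto
    show "w [^] (p ^ e choose j) = \<one>"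
      if "3 \<le> j" "j \<le> 2 * c" "w \<in> lower_central G (Suc d)" for j w
    proof (cases "j < p")
      case True
      then show ?thesis using that lower_central_carrier by (intro small) auto
    qed (use that large in auto)
  qed
  moreover have "ord k \<noteq> 0" using ord_k p3 by simp
  ultimately show ?thesis using kc ord_k by (simp add: witnesses_def)
qed

theorem theorem4p6:
  fixes G :: "('a, 'b) monoid_scheme" and p c :: nat
  assumes "Factorial_Ring.prime p" and "odd p"
    and "group G" and "finite (carrier G)" and "\<exists>a. order G = p ^ a"
    and "has_nilpotency_class G c"
  shows "(int p > 2 * int c - 1 \<longrightarrow>
            big_elements G \<subseteq> witnesses G \<and> J_group G) \<and>
         (int p ^ 2 > 2 * int c - 1 \<longrightarrow>
            big_elements (lower_central_group G (exponent_depth G)) \<subseteq> witnesses G \<and> J_group G)"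
proof -
  interpret group G by fact
  note p = assms(1,2) and fin = assms(4)
  obtain a where a: "order G = p ^ a" using assms(5) by blast
  have c: "lower_central G (Suc c) = {\<one>\<^bsub>G\<^esub>}"
    using assms(6) by (simp add: has_nilpotency_class_def)
  obtain b where b: "b \<in> big_elements G"
    using prime_power_group_big_element [OF p(1) a] .
  have "group_exponent G dvd p ^ a"
    using pow_order_eq_1 a by (intro pow_group_exponent_dvd) simp
  then obtain e where e: "group_exponent G = p ^ e"
    using p(1) by (auto simp: divides_primepow_nat)
  have exponent: "w [^]\<^bsub>G\<^esub> (p ^ e) = \<one>\<^bsub>G\<^esub>" if "w \<in> carrier G" for w
    using group_exponent_pow [OF that] e by simp
  have big: "k \<in> witnesses G"
    if "k \<in> big_elements G" "2 * c < p" for k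
    using that e by (intro prime_power_witness [OF p fin c, where d = 1 and e = e] exponent)
      (auto simp: big_elements_def)
  have big_deep: "k \<in> witnesses G"
    if k: "k \<in> big_elements (lower_central_group G (exponent_depth G))" and p2: "2 * c < p ^ 2" for k
  proof (cases "c = 0")
    case True
    \<comment> \<open>The trivial group, where \<open>n = 1\<close> and \<open>n / p\<close> makes no sense.\<close>
    then have triv: "carrier G = {\<one>\<^bsub>G\<^esub>}" using c by simp
    then have "lower_central_group G (exponent_depth G) = G"
      unfolding exponent_depth_def by simp
    then have "k \<in> big_elements G" using k by simp
    then show ?thesis using big True p(1) prime_gt_0_nat by auto
  next
    case False
    have "e \<noteq> 0"
    proof
      assume "e = 0"
      then have "carrier G = {\<one>\<^bsub>G\<^esub>}" using exponent by fastforce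
      then show False using assms(6) False by (auto simp: has_nilpotency_class_def)
    qed
    then obtain e' where e': "e = Suc e'" by (cases e) auto
    have nontriv: "group_exponent G \<noteq> 1"
      using e e' p(1) by (auto simp: prime_nat_iff)
    let ?d = "exponent_depth G"
    note depth = exponent_depth_maximal [OF c nontriv]
    have kd: "k \<in> lower_central G ?d" and ord_k: "ord k = p ^ e"
      using k depth(1) e ord_subgroup [OF lower_central_subgroup, of k ?d]
      by (auto simp: big_elements_def)
    let ?E = "group_exponent (lower_central_group G (Suc ?d))"
    have "?E dvd group_exponent (G\<lparr>carrier := carrier G\<rparr>)"
      using lower_central_carrier by (intro group_exponent_subgroup_dvd lower_central_subgroup subgroup_self)
    then have "?E dvd p ^ Suc e'" using e e' by simp
    then obtain i where i: "i \<le> Suc e'" "?E = p ^ i"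
      using divides_primepow_nat [OF p(1)] by blast
    then have "i \<le> e'" using depth(2) e e' by (cases "i = Suc e'") auto
    then have E: "?E dvd p ^ e'" using i by (simp add: le_imp_power_dvd)
    show ?thesis
    proof (rule prime_power_witness [OF p fin c kd ord_k exponent])
      fix j w assume j: "p \<le> j" "j \<le> 2 * c" and w: "w \<in> lower_central G (Suc ?d)"
      interpret L: group "lower_central_group G (Suc ?d)"
        using lower_central_subgroup by (rule subgroup_imp_group)
      have wc: "w \<in> carrier G" using w lower_central_carrier by blast
      have "w [^]\<^bsub>G\<^esub> ?E = \<one>\<^bsub>G\<^esub>"
        using L.group_exponent_pow [of w] w nat_pow_consistent [of w ?E "lower_central G (Suc ?d)"] by simp
      moreover have "p ^ e' dvd (p ^ e choose j)"
        unfolding e' using j p2 prime_gt_0_nat [OF p(1)]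
        by (intro prime_power_dvd_binomial_Suc [OF p(1)]) auto
      ultimately show "w [^]\<^bsub>G\<^esub> (p ^ e choose j) = \<one>\<^bsub>G\<^esub>"
        using pow_eq_one_if_dvd [OF wc] E dvd_trans by blast
    qed
  qed
  \<comment> \<open>Parity sharpens the bound \<open>2 c - 1\<close> to \<open>2 c\<close>, the last degree in which the filtration can be nontrivial.\<close>
  have odd_bound: "2 * c < m" if "odd m" "2 * int c - 1 < int m" for m :: nat
    using that by presburger
  have nonempty: "\<exists>k. k \<in> big_elements (lower_central_group G (exponent_depth G))"
  proof -
    interpret L: group "lower_central_group G (exponent_depth G)"
      using lower_central_subgroup by (rule subgroup_imp_group)
    have "order (lower_central_group G (exponent_depth G)) dvd p ^ a"
      using lagrange [OF lower_central_subgroup, of "exponent_depth G"] a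
      by (simp add: order_def) (metis dvd_triv_right)
    then obtain i where "order (lower_central_group G (exponent_depth G)) = p ^ i"
      using p(1) by (auto simp: divides_primepow_nat)
    then show ?thesis using L.prime_power_group_big_element [OF p(1)] by blast
  qed
  show ?thesis
  proof (intro conjI impI)
    assume "int p > 2 * int c - 1"
    then have "2 * c < p" using odd_bound p(2) by blast
    then show "big_elements G \<subseteq> witnesses G" using big by blast
    then show "J_group G" using b J_group_if_witness by blast
  next
    assume "int p ^ 2 > 2 * int c - 1"
    then have "2 * c < p ^ 2" using odd_bound [of "p ^ 2"] p(2) by simp
    then show "big_elements (lower_central_group G (exponent_depth G)) \<subseteq> witnesses G"
      using big_deep by blast
    then show "J_group G" using nonempty J_group_if_witness by blast
  qed
qed

end
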